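(* Let $\mathcal P$ be a convex set, let $f_1$ be $\beta$-smooth, non-negative, monotone and DR-submodular on $\mathcal P$, and let $f_2$ be non-negative and concave on $\mathcal P$. Let $x^*$ be a point maximizing $f_1+f_2$ over $\mathcal P$, and let $\Delta\ge\max_{x,y\in\mathcal P}\|x-y\|_2$. Consider the stochastic proximal gradient iteration started at $x^{(0)}\in\mathcal P$, $$x^{(t+1)}=\mathrm{prox}_{-\eta_tf_2}\bigl(x^{(t)}+\eta_tv^{(t)}\bigr),\qquad \mathbb E[v^{(t)}]=\nabla f_1(x^{(t)}).$$ Suppose that for some $\sigma>0$ the stochastic gradients satisfy $\mathbb E\|v^{(t)}-\nabla f_1(x^{(t)})\|_2^2\le\sigma^2$ for all $t$. Then for all $T>0$, if $\eta_t=\eta=1/\bigl(\beta+\frac{\sigma}{\Delta}\sqrt{2T}\bigr)$ for all $t$, then $$\mathbb E\Bigl[\max_{t=0,1,\dots,T}(f_1+f_2)(x^{(t)})\Bigr]\ \ge\ \frac12(f_1+f_2)(x^* )-\frac{\beta\Delta^2}{4T}-\frac{\sigma\Delta}{\sqrt{2T}}.$$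
   Context: $\mathcal P\subseteq\mathbb R_{\ge0}^d$. For a convex function $\phi$, $\mathrm{prox}_\phi(x)=\arg\min_{y\in\mathcal P}\bigl(\phi(y)+\frac12\|x-y\|_2^2\bigr)$. A function $f$ is monotone if $x\le y$ (coordinatewise) implies $f(x)\le f(y)$; DR-submodular if $f(x+\delta e_i)-f(x)\ge f(y+\delta e_i)-f(y)$ for all $x\le y$, all standard unit vectors $e_i$ and all $\delta>0$; $\beta$-smooth if it has gradients everywhere and $\|\nabla f(x)-\nabla f(y)\|_2\le\beta\|x-y\|_2$ for all $x,y$. The vectors $v^{(t)}$ are random; the unbiasedness condition $\mathbb E[v^{(t)}]=\nabla f_1(x^{(t)})$ is understood conditionally on the iterates up to $x^{(t)}$. $T$ is an integer.
   Formalization: Smoothness, non-negativity, monotonicity and DR-submodularity of f1 are assumed on a product of intervals containing P (such as the nonnegative orthant), not only on P; with P={(s,1-s)} and f1=s^2 the claim read only on P fails. *)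

theory Defs
  imports "HOL-Probability.Probability"
begin

text \<open>
  The domain \<open>D\<close> of a function is kept explicit. All orders on \<open>real ^ 'n\<close> are coordinatewise;
  \<open>is_interval D\<close> says exactly that \<open>D\<close> is a product of (possibly unbounded) real intervals,
  e.g. the nonnegative orthant.
\<close>

definition dr_submodular_on :: "(real ^ 'n) set \<Rightarrow> (real ^ 'n \<Rightarrow> real) \<Rightarrow> bool" where
  "dr_submodular_on D f \<longleftrightarrow>
     (\<forall>x\<in>D. \<forall>y\<in>D. \<forall>i. \<forall>\<delta>>0. x \<le> y \<longrightarrow>
        x + \<delta> *\<^sub>R axis i 1 \<in> D \<longrightarrow> y + \<delta> *\<^sub>R axis i 1 \<in> D \<longrightarrow>
        f (x + \<delta> *\<^sub>R axis i 1) - f x \<ge> f (y + \<delta> *\<^sub>R axis i 1) - f y)"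

text \<open>
  The derivative is taken within \<open>D\<close>, so that points on the boundary of \<open>D\<close> are covered without
  reference to values of \<open>f\<close> outside \<open>D\<close>. Note that \<open>lipschitz_on\<close> includes \<open>0 \<le> \<beta>\<close>.
\<close>

definition smooth_with_gradient_on ::
    "real \<Rightarrow> (real ^ 'n) set \<Rightarrow> (real ^ 'n \<Rightarrow> real) \<Rightarrow> (real ^ 'n \<Rightarrow> real ^ 'n) \<Rightarrow> bool" where
  "smooth_with_gradient_on \<beta> D f g \<longleftrightarrow>
     (\<forall>x\<in>D. (f has_derivative (\<lambda>h. g x \<bullet> h)) (at x within D)) \<and> \<beta>-lipschitz_on D g"

text \<open>
  \<open>is_prox P \<phi> x z\<close> means \<open>z = prox\<^sub>\<phi>(x)\<close>. It is a relation because the minimum over \<open>P\<close> need not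
  be attained when \<open>P\<close> is not closed; for convex \<open>\<phi>\<close> the minimizer is unique if it exists.
\<close>

definition is_prox ::
    "(real ^ 'n) set \<Rightarrow> (real ^ 'n \<Rightarrow> real) \<Rightarrow> real ^ 'n \<Rightarrow> real ^ 'n \<Rightarrow> bool" where
  "is_prox P \<phi> x z \<longleftrightarrow> is_arg_min (\<lambda>y. \<phi> y + 1 / 2 * (norm (x - y))\<^sup>2) (\<lambda>y. y \<in> P) z"

text \<open>The \<open>\<sigma>\<close>-algebra generated by \<open>X 0, \<dots>, X t\<close>.\<close>

definition history_algebra ::
    "'w measure \<Rightarrow> (nat \<Rightarrow> 'w \<Rightarrow> real ^ 'n) \<Rightarrow> nat \<Rightarrow> 'w measure" where
  "history_algebra M X t =
     sigma (space M) {X s -` A \<inter> space M | s A. s \<le> t \<and> A \<in> sets borel}"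

end

theory Submission
  imports Defs
begin

text \<open>
  DR-submodularity makes \<open>f1\<close> concave along nonnegative and along nonpositive directions. Applied to
  the two halves of \<open>y - x = (x \<squnion> y - x) + (x \<sqinter> y - x)\<close>, this gives
  \<open>\<nabla>f1(x) \<bullet> (y - x) \<ge> f1(y) - 2 f1(x)\<close> for monotone nonnegative \<open>f1\<close>.
  Write \<open>c = 1/\<eta> - \<beta>\<close> and \<open>e\<^sub>t = v\<^sub>t - \<nabla>f1(x\<^sub>t)\<close>. Combined with the three-point inequality of the
  proximal step, smoothness and the weighted AM-GM inequality, one gets
  \<open>F(x\<^sup>*) + e\<^sub>t \<bullet> (x\<^sup>* - x\<^sub>t) \<le> f1(x\<^sub>t) + F(x\<^sub>t\<^sub>+\<^sub>1) +
  (\<parallel>x\<^sub>t - x\<^sup>*\<parallel>\<^sup>2 - \<parallel>x\<^sub>t\<^sub>+\<^sub>1 - x\<^sup>*\<parallel>\<^sup>2) / (2\<eta>) + \<parallel>e\<^sub>t\<parallel>\<^sup>2 / (2c)\<close>, where \<open>F = f1 + f2\<close>.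
  Summing over \<open>t < T\<close> telescopes the distances, and the term linear in \<open>e\<^sub>t\<close> vanishes in
  expectation because \<open>x\<^sub>t\<close> is measurable with respect to the history.
\<close>

section \<open>DR-submodular functions: increments, secants and the gradient bound\<close>

lemma is_interval_between_cart:
  fixes D :: "(real ^ 'n) set"
  assumes "is_interval D" "a \<in> D" "b \<in> D"
    and "\<And>i. a $ i \<le> z $ i \<and> z $ i \<le> b $ i \<or> b $ i \<le> z $ i \<and> z $ i \<le> a $ i"
  shows "z \<in> D"
  using assms unfolding is_interval_cart by blast

text \<open>The definition compares increments along one axis only; here the coordinates of
  \<open>h\<close> are switched on one at a time and the inequalities add up. All intermediate
  points lie coordinatewise between \<open>z\<close> and \<open>z + h\<close>, so the interval
  \<open>D\<close> contains them.\<close>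

lemma dr_submodular_on_increment:
  fixes f :: "real ^ 'n \<Rightarrow> real"
  assumes "is_interval D" and dr: "dr_submodular_on D f"
    and D: "x \<in> D" "x + h \<in> D" "y \<in> D" "y + h \<in> D"
    and "x \<le> y" "0 \<le> h"
  shows "f (y + h) - f y \<le> f (x + h) - f x"
proof -
  define r where "r S = (\<chi> i. if i \<in> S then h $ i else 0)" for S
  have h: "0 \<le> h $ i" for i
    using \<open>0 \<le> h\<close> by (simp add: less_eq_vec_def)
  have in_D: "z + r S \<in> D" if "z \<in> D" "z + h \<in> D" for z S
    by (rule is_interval_between_cart[OF assms(1) that]) (use h in \<open>auto simp: r_def\<close>)
  have "f (y + r S) - f y \<le> f (x + r S) - f x" if "finite S" for S
    using that
  proof (induction S)
    case empty
    have "r {} = 0" by (simp add: r_def vec_eq_iff)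
    then show ?case by simp
  next
    case (insert i S)
    have eq: "z + r (insert i S) = (z + r S) + (h $ i) *\<^sub>R axis i 1" for z
      using insert.hyps by (auto simp: r_def vec_eq_iff axis_def)
    have "f (y + r (insert i S)) - f (y + r S) \<le> f (x + r (insert i S)) - f (x + r S)"
    proof (cases "h $ i = 0")
      case True
      then show ?thesis by (simp add: eq)
    next
      case False
      then have "0 < h $ i" using h[of i] by simp
      moreover have "x + r S \<le> y + r S" using \<open>x \<le> y\<close> by (simp add: less_eq_vec_def)
      ultimately show ?thesis
        using dr in_D[of x S] in_D[of y S] in_D[of x "insert i S"] in_D[of y "insert i S"] D
        unfolding dr_submodular_on_def eq by blast
    qed
    with insert.IH show ?case by simp
  qed
  moreover have "r UNIV = h" by (simp add: r_def vec_eq_iff)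
  ultimately show ?thesis by (metis finite)
qed

lemma has_real_derivative_along_line:
  fixes f :: "'a::real_normed_vector \<Rightarrow> real"
  assumes f: "(f has_derivative f') (at (x + s *\<^sub>R h) within D)"
    and S: "\<And>r. r \<in> S \<Longrightarrow> x + r *\<^sub>R h \<in> D"
  shows "((\<lambda>r. f (x + r *\<^sub>R h)) has_real_derivative f' h) (at s within S)"
proof -
  have "((\<lambda>r. x + r *\<^sub>R h) has_derivative (\<lambda>r. r *\<^sub>R h)) (at s within S)"
    by (auto intro!: derivative_eq_intros)
  moreover have "(f has_derivative f') (at (x + s *\<^sub>R h) within (\<lambda>r. x + r *\<^sub>R h) ` S)"
    using f by (rule has_derivative_subset) (use S in auto)
  ultimately have "((\<lambda>r. f (x + r *\<^sub>R h)) has_derivative (\<lambda>r. f' (r *\<^sub>R h))) (at s within S)"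
    by (rule has_derivative_in_compose)
  moreover have "f' (r *\<^sub>R h) = f' h * r" for r
    using linear_scale[OF has_derivative_linear[OF f], of r h] by simp
  ultimately show ?thesis by (simp add: has_field_derivative_def)
qed

text \<open>Discrete concavity along \<open>h\<close>: when the segment is cut into
  \<open>Suc n\<close> equal steps, no step gains more than the first one. The sign condition on
  \<open>h\<close> makes the cut points comparable in the coordinatewise order.\<close>

lemma dr_submodular_on_secant:
  fixes f :: "real ^ 'n \<Rightarrow> real"
  assumes D: "is_interval D" and dr: "dr_submodular_on D f"
    and x: "x \<in> D" "x + h \<in> D"
    and h: "0 \<le> h \<or> h \<le> 0"
  shows "f (x + h) - f x \<le> real (Suc n) * (f (x + (1 / real (Suc n)) *\<^sub>R h) - f x)"
proof -
  define p where "p k = x + (real k / real (Suc n)) *\<^sub>R h" for k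
  have seg: "x + s *\<^sub>R h \<in> D" if "0 \<le> s" "s \<le> 1" for s
    using convexD_alt[OF is_interval_convex[OF D] x, of s] that by (simp add: algebra_simps)
  have p_D: "p k \<in> D" if "k \<le> Suc n" for k
    unfolding p_def using that by (intro seg) auto
  have p_Suc: "p (Suc k) = p k + (1 / real (Suc n)) *\<^sub>R h" for k
    by (simp add: p_def add_divide_distrib scaleR_add_left add.commute)
  have [simp]: "p 0 = x" "p (Suc n) = x + h" by (simp_all add: p_def)
  have step: "f (p (Suc k)) - f (p k) \<le> f (p 1) - f x" if "k < Suc n" for k
    using h
  proof
    assume "0 \<le> h"
    then have "0 \<le> (1 / real (Suc n)) *\<^sub>R h" "x \<le> p k"
      by (simp_all add: p_def less_eq_vec_def)
    then show ?thesis
      using dr_submodular_on_increment[OF D dr, of x "(1 / real (Suc n)) *\<^sub>R h" "p k"]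
        p_D[of 0] p_D[of 1] p_D[of k] p_D[of "Suc k"] p_Suc[of 0] p_Suc[of k] that
      by simp
  next
    \<comment> \<open>Here the cut points decrease, so the increment inequality is applied to the
      backward steps: from \<open>p (Suc k)\<close> to \<open>p k\<close> and from the larger point
      \<open>p 1\<close> to \<open>x\<close>.\<close>
    assume h: "h \<le> 0"
    let ?d = "- ((1 / real (Suc n)) *\<^sub>R h)"
    have "p (Suc k) \<le> p 1"
      unfolding p_def less_eq_vec_def
      using h mult_right_mono_neg[of 1 "1 + real k"]
      by (auto simp: less_eq_vec_def intro!: divide_right_mono)
    moreover have "0 \<le> ?d" using h by (simp add: less_eq_vec_def divide_nonpos_nonneg)
    moreover have "p (Suc k) + ?d = p k" "p 1 + ?d = x"
      using p_Suc[of k] p_Suc[of 0] by simp_all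
    ultimately have "f x - f (p 1) \<le> f (p k) - f (p (Suc k))"
      using dr_submodular_on_increment[OF D dr, of "p (Suc k)" ?d "p 1"]
        p_D[of 0] p_D[of 1] p_D[of k] p_D[of "Suc k"] that by simp
    then show ?thesis by simp
  qed
  have "f (x + h) - f x = (\<Sum>k<Suc n. f (p (Suc k)) - f (p k))"
    by (subst sum_lessThan_telescope) simp
  also have "\<dots> \<le> (\<Sum>k<Suc n. f (p 1) - f x)"
    using step by (intro sum_mono) auto
  finally show ?thesis by (simp add: p_def)
qed

text \<open>The right-hand side of the secant bound is a difference quotient at \<open>x\<close>
  with step \<open>1 / Suc n\<close>; letting \<open>n\<close> grow turns it into the directional
  derivative. Only a one-sided limit is involved, so \<open>x\<close> may lie on the boundary of
  \<open>D\<close>.\<close>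

lemma dr_submodular_on_le_gradient:
  fixes f :: "real ^ 'n \<Rightarrow> real"
  assumes D: "is_interval D" and dr: "dr_submodular_on D f"
    and f: "(f has_derivative f') (at x within D)"
    and x: "x \<in> D" "x + h \<in> D"
    and h: "0 \<le> h \<or> h \<le> 0"
  shows "f (x + h) - f x \<le> f' h"
proof -
  have "x + s *\<^sub>R h \<in> D" if "s \<in> {0..1}" for s
    using convexD_alt[OF is_interval_convex[OF D] x, of s] that by (simp add: algebra_simps)
  then have "((\<lambda>s. f (x + s *\<^sub>R h)) has_real_derivative f' h) (at 0 within {0..1})"
    using f by (intro has_real_derivative_along_line[where D = D]) auto
  then have lim: "((\<lambda>s. (f (x + s *\<^sub>R h) - f x) / s) \<longlongrightarrow> f' h) (at 0 within {0..1})"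
    by (simp add: has_field_derivative_iff)
  have "filterlim (\<lambda>n. 1 / real (Suc n)) (at 0 within {0..1}) sequentially"
    using LIMSEQ_inverse_real_of_nat
    by (auto simp: filterlim_at inverse_eq_divide intro!: always_eventually)
  from filterlim_compose[OF lim this]
  have "(\<lambda>n. real (Suc n) * (f (x + (1 / real (Suc n)) *\<^sub>R h) - f x)) \<longlonglongrightarrow> f' h"
    by (simp add: mult.commute)
  then show ?thesis
    by (rule LIMSEQ_le_const) (use dr_submodular_on_secant[OF D dr x h] in auto)
qed

lemma dr_submodular_on_gradient_bound:
  fixes f :: "real ^ 'n \<Rightarrow> real"
  assumes D: "is_interval D" and dr: "dr_submodular_on D f"
    and f: "(f has_derivative f') (at x within D)"
    and mono: "mono_on D f" and nonneg: "\<And>z. z \<in> D \<Longrightarrow> 0 \<le> f z"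
    and x: "x \<in> D" and y: "y \<in> D"
  shows "f y - 2 * f x \<le> f' (y - x)"
proof -
  define u l where "u = (\<chi> i. max (x $ i) (y $ i))" and "l = (\<chi> i. min (x $ i) (y $ i))"
  have D': "u \<in> D" "l \<in> D"
    by (rule is_interval_between_cart[OF D x y]; auto simp: u_def l_def)+
  have "f u - f x \<le> f' (u - x)"
    using dr_submodular_on_le_gradient[OF D dr f, of "u - x"] x D'
    by (auto simp: u_def less_eq_vec_def)
  moreover have "f l - f x \<le> f' (l - x)"
    using dr_submodular_on_le_gradient[OF D dr f, of "l - x"] x D'
    by (auto simp: l_def less_eq_vec_def)
  moreover have "f' (u - x) + f' (l - x) = f' (y - x)"
  proof -
    have "(u - x) + (l - x) = y - x"
      by (auto simp: u_def l_def vec_eq_iff)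
    then show ?thesis
      by (metis linear_add[OF has_derivative_linear[OF f]])
  qed
  \<comment> \<open>Monotonicity trades \<open>f u\<close> for \<open>f y\<close>, and nonnegativity
    discards \<open>f l\<close>. What remains is \<open>2 * f x\<close> instead of
    \<open>f x\<close>, the source of the factor 1/2 in the final guarantee.\<close>
  moreover have "f y \<le> f u"
    using mono D' y by (auto simp: u_def less_eq_vec_def intro: mono_onD)
  moreover have "0 \<le> f l" using nonneg D' by blast
  ultimately show ?thesis by linarith
qed

section \<open>The quadratic lower bound for smooth functions\<close>

lemma smooth_with_gradient_on_lower_bound:
  fixes f :: "real ^ 'n \<Rightarrow> real"
  assumes "convex D" and f: "smooth_with_gradient_on \<beta> D f g"
    and x: "x \<in> D" and y: "y \<in> D"
  shows "f x + g x \<bullet> (y - x) - \<beta> / 2 * (norm (y - x))\<^sup>2 \<le> f y"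
proof -
  define h where "h = y - x"
  \<comment> \<open>The claim is exactly \<open>p 0 \<le> p 1\<close>. The quadratic term is chosen
    so that its derivative compensates the largest decrease of the gradient along \<open>h\<close>
    that the Lipschitz condition allows.\<close>
  define p where "p s = f (x + s *\<^sub>R h) - s * (g x \<bullet> h) + \<beta> / 2 * s\<^sup>2 * (norm h)\<^sup>2" for s
  have seg: "x + s *\<^sub>R h \<in> D" if "s \<in> {0..1}" for s
    using convexD_alt[OF \<open>convex D\<close> x y, of s] that by (simp add: h_def algebra_simps)
  have p': "(p has_real_derivative (g (x + s *\<^sub>R h) - g x) \<bullet> h + \<beta> * s * (norm h)\<^sup>2) (at s within {0..1})"
    if "s \<in> {0..1}" for s
  proof -
    have "(f has_derivative (\<bullet>) (g (x + s *\<^sub>R h))) (at (x + s *\<^sub>R h) within D)"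
      using f seg[OF that] by (auto simp: smooth_with_gradient_on_def)
    then have "((\<lambda>s. f (x + s *\<^sub>R h)) has_real_derivative g (x + s *\<^sub>R h) \<bullet> h) (at s within {0..1})"
      by (rule has_real_derivative_along_line) (rule seg)
    then show ?thesis
      unfolding p_def
      by (auto intro!: derivative_eq_intros simp: inner_diff_left)
  qed
  have p'_nonneg: "0 \<le> (g (x + s *\<^sub>R h) - g x) \<bullet> h + \<beta> * s * (norm h)\<^sup>2" if "s \<in> {0..1}" for s
  proof -
    have "norm (g (x + s *\<^sub>R h) - g x) \<le> \<beta> * (s * norm h)"
      using f lipschitz_onD[of \<beta> D g "x + s *\<^sub>R h" x] seg[OF that] x that
      by (auto simp: smooth_with_gradient_on_def dist_norm)
    then have "norm (g (x + s *\<^sub>R h) - g x) * norm h \<le> \<beta> * (s * norm h) * norm h"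
      by (rule mult_right_mono) simp
    moreover have "- (norm (g (x + s *\<^sub>R h) - g x) * norm h) \<le> (g (x + s *\<^sub>R h) - g x) \<bullet> h"
      using Cauchy_Schwarz_ineq2[of "g (x + s *\<^sub>R h) - g x" h] by linarith
    ultimately show ?thesis by (simp add: power2_eq_square algebra_simps)
  qed
  have "p 0 \<le> p 1"
  \<comment> \<open>Two-sided derivatives are asked for only at interior points of
    \<open>{0..1}\<close>, where the derivative within the interval is an ordinary one; at the
    endpoints continuity suffices.\<close>
  proof (rule DERIV_nonneg_imp_increasing_open[of 0 1 p])
    show "continuous_on {0..1} p"
      using p' by (meson DERIV_continuous continuous_on_eq_continuous_within)
    show "\<exists>y. (p has_real_derivative y) (at s) \<and> 0 \<le> y" if "0 < s" "s < 1" for s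
      using p'[of s] p'_nonneg[of s] that by (auto simp: at_within_Icc_at)
  qed simp
  then show ?thesis by (simp add: p_def h_def)
qed

section \<open>The proximal map: three-point inequality and measurability\<close>

text \<open>The proximal objective is 1-strongly convex, so it grows quadratically away from its
  minimizer. The proof compares \<open>z\<close> with a point \<open>w\<close> on the segment
  towards \<open>y\<close>, divides by the weight \<open>r\<close> and lets \<open>r\<close> tend to
  0.\<close>

lemma is_prox_three_point:
  fixes \<phi> :: "real ^ 'n \<Rightarrow> real"
  assumes prox: "is_prox P \<phi> u z" and conv: "convex_on P \<phi>" and y: "y \<in> P"
  shows "\<phi> z + 1 / 2 * (norm (u - z))\<^sup>2 + 1 / 2 * (norm (y - z))\<^sup>2 \<le> \<phi> y + 1 / 2 * (norm (u - y))\<^sup>2"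
proof -
  have z: "z \<in> P"
    and min: "\<And>w. w \<in> P \<Longrightarrow> \<phi> z + 1 / 2 * (norm (u - z))\<^sup>2 \<le> \<phi> w + 1 / 2 * (norm (u - w))\<^sup>2"
    using prox by (auto simp: is_prox_def is_arg_min_linorder)
  define c where "c = \<phi> y + 1 / 2 * (norm (u - y))\<^sup>2 - (\<phi> z + 1 / 2 * (norm (u - z))\<^sup>2)"
  have "(1 - r) * (1 / 2 * (norm (y - z))\<^sup>2) \<le> c" if r: "0 < r" "r < 1" for r
  proof -
    define w where "w = (1 - r) *\<^sub>R z + r *\<^sub>R y"
    have "w \<in> P"
      unfolding w_def using convexD_alt[OF convex_on_imp_convex[OF conv] z y, of r] r by simp
    have "\<phi> w \<le> (1 - r) * \<phi> z + r * \<phi> y"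
      unfolding w_def using convex_onD[OF conv, of r z y] r z y by simp
    \<comment> \<open>This identity quantifies the strong convexity of the squared norm; its last
      term yields the extra distance between \<open>y\<close> and \<open>z\<close>.\<close>
    moreover have "(norm (u - w))\<^sup>2 =
        (1 - r) * (norm (u - z))\<^sup>2 + r * (norm (u - y))\<^sup>2 - r * (1 - r) * (norm (y - z))\<^sup>2"
      unfolding power2_norm_eq_inner w_def
      by (simp add: inner_add_left inner_add_right inner_diff_left inner_diff_right inner_commute algebra_simps)
    ultimately have "r * ((1 - r) * (1 / 2 * (norm (y - z))\<^sup>2)) \<le> r * c"
      using min[OF \<open>w \<in> P\<close>] by (simp add: c_def field_simps)
    then show ?thesis using r by simp
  qed
  then have "\<forall>\<^sub>F r in at_right 0. (1 - r) * (1 / 2 * (norm (y - z))\<^sup>2) \<le> c"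
    by (auto simp: eventually_at_right_field intro!: exI[of _ 1])
  moreover have "((\<lambda>r. (1 - r) * (1 / 2 * (norm (y - z))\<^sup>2)) \<longlongrightarrow> (1 - 0) * (1 / 2 * (norm (y - z))\<^sup>2)) (at_right 0)"
    by (intro tendsto_intros)
  ultimately have "1 / 2 * (norm (y - z))\<^sup>2 \<le> c"
    using tendsto_upperbound[of _ _ "at_right (0::real)"] by fastforce
  then show ?thesis by (simp add: c_def)
qed

text \<open>
  The function \<open>\<phi>\<close> itself may be non-measurable on the relative boundary of \<open>P\<close>; only its values
  at proximal points depend measurably on the data, because the proximal objective has open
  strict sublevel sets in \<open>u\<close>.
\<close>

lemma borel_measurable_is_prox:
  fixes \<phi> :: "real ^ 'n \<Rightarrow> real"
  assumes u [measurable]: "u \<in> borel_measurable M" and z [measurable]: "z \<in> borel_measurable M"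
    and prox: "\<And>\<omega>. \<omega> \<in> space M \<Longrightarrow> is_prox P \<phi> (u \<omega>) (z \<omega>)"
  shows "(\<lambda>\<omega>. \<phi> (z \<omega>)) \<in> borel_measurable M"
proof -
  define opt where "opt \<omega> = \<phi> (z \<omega>) + 1 / 2 * (norm (u \<omega> - z \<omega>))\<^sup>2" for \<omega>
  have "opt \<in> borel_measurable M"
    unfolding borel_measurable_iff_less
  proof
    fix a
    define U where "U = (\<Union>y\<in>P. {w. \<phi> y + 1 / 2 * (norm (w - y))\<^sup>2 < a})"
    have "open U"
      unfolding U_def by (intro open_UN ballI open_Collect_less continuous_intros)
    \<comment> \<open>For one inclusion \<open>z \<omega>\<close> itself is the witness in
      \<open>P\<close>; the other is minimality. Each set in the union is open because
      \<open>\<phi> y\<close> is a constant there, whatever the regularity of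
      \<open>\<phi>\<close>.\<close>
    have "{\<omega> \<in> space M. opt \<omega> < a} = u -` U \<inter> space M"
      using prox unfolding U_def opt_def is_prox_def is_arg_min_linorder
      by (auto intro: le_less_trans)
    also have "\<dots> \<in> sets M"
      using \<open>open U\<close> by (intro measurable_sets[OF u]) auto
    finally show "{\<omega> \<in> space M. opt \<omega> < a} \<in> sets M" .
  qed
  then have "(\<lambda>\<omega>. opt \<omega> - 1 / 2 * (norm (u \<omega> - z \<omega>))\<^sup>2) \<in> borel_measurable M"
    by measurable
  then show ?thesis by (simp add: opt_def)
qed

section \<open>The history algebra and conditional unbiasedness\<close>

lemma history_algebra_generators:
  "{X s -` A \<inter> space M | s A. s \<le> t \<and> A \<in> sets borel} \<subseteq> Pow (space M)"
  by blast

lemma subalgebra_history_algebra: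
  assumes "\<And>s. X s \<in> borel_measurable M"
  shows "subalgebra M (history_algebra M X t)"
  unfolding subalgebra_def history_algebra_def
    space_measure_of[OF history_algebra_generators] sets_measure_of[OF history_algebra_generators]
  using assms by (auto intro!: sets.sigma_sets_subset intro: measurable_sets)

lemma measurable_history_algebra:
  "X t \<in> borel_measurable (history_algebra M X t)"
  unfolding history_algebra_def
  by (rule measurableI)
    (auto simp: space_measure_of[OF history_algebra_generators] sets_measure_of[OF history_algebra_generators])

lemma integrable_norm_of_square_integrable:
  fixes e :: "'w \<Rightarrow> 'a::{banach, second_countable_topology}"
  assumes "finite_measure M" and e: "e \<in> borel_measurable M"
    and sq: "integrable M (\<lambda>\<omega>. (norm (e \<omega>))\<^sup>2)"
  shows "integrable M e"
proof -
  have "(\<lambda>\<omega>. norm (e \<omega>)) \<in> borel_measurable M" using e by measurable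
  then have "integrable M (\<lambda>\<omega>. norm (e \<omega>))"
    using sq by (rule finite_measure.square_integrable_imp_integrable[OF assms(1)])
  then show ?thesis using e by (simp add: integrable_norm_iff)
qed

text \<open>A bounded \<open>F\<close>-measurable \<open>w\<close> can be pulled out of the
  conditional expectation, so \<open>v\<close> and \<open>g\<close> have the same expected inner
  product with \<open>w\<close>. The argument runs by coordinates because
  \<open>real_cond_exp\<close> acts on real-valued functions.\<close>

lemma integral_inner_cond_exp_deviation:
  fixes v g w :: "'w \<Rightarrow> real ^ 'n"
  assumes M: "prob_space M" and F: "subalgebra M F"
    and v: "v \<in> borel_measurable M" and g: "integrable M g"
    and e: "integrable M (\<lambda>\<omega>. v \<omega> - g \<omega>)"
    and w: "w \<in> borel_measurable F" and w_bound: "\<And>\<omega>. \<omega> \<in> space M \<Longrightarrow> norm (w \<omega>) \<le> B"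
    and unbiased: "\<And>i. AE \<omega> in M. real_cond_exp M F (\<lambda>\<omega>'. v \<omega>' $ i) \<omega> = g \<omega> $ i"
  shows "integrable M (\<lambda>\<omega>. (v \<omega> - g \<omega>) \<bullet> w \<omega>)" (is ?int)
    and "(\<integral>\<omega>. (v \<omega> - g \<omega>) \<bullet> w \<omega> \<partial>M) = 0" (is ?zero)
proof -
  interpret prob_space M by fact
  interpret finite_measure_subalgebra M F by unfold_locales fact
  have wF: "(\<lambda>\<omega>. w \<omega> $ i) \<in> borel_measurable F" for i
    by (rule measurable_compose[OF w borel_measurable_continuous_onI]) (intro continuous_intros)
  have wM: "(\<lambda>\<omega>. w \<omega> $ i) \<in> borel_measurable M" for i
    using measurable_from_subalg[OF F wF] .
  have vM: "(\<lambda>\<omega>. v \<omega> $ i) \<in> borel_measurable M" for i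
    by (rule measurable_compose[OF v borel_measurable_continuous_onI]) (intro continuous_intros)
  have bnd: "AE \<omega> in M. norm (w \<omega> $ i) \<le> B" for i
    using w_bound component_le_norm_cart[of _ i] by (auto intro!: AE_I2 intro: order_trans)
  have int_nth: "integrable M (\<lambda>\<omega>. h \<omega> $ i)" if "integrable M h" for h :: "'w \<Rightarrow> real ^ 'n" and i
    using integrable_inner_left[OF that, of "axis i 1"] by (simp add: inner_axis)
  have int_mult: "integrable M (\<lambda>\<omega>. w \<omega> $ i * h \<omega> $ i)" if "integrable M h" for h :: "'w \<Rightarrow> real ^ 'n" and i
  proof (rule Bochner_Integration.integrable_bound)
    show "integrable M (\<lambda>\<omega>. B * h \<omega> $ i)" using int_nth[OF that] by simp
    show "(\<lambda>\<omega>. w \<omega> $ i * h \<omega> $ i) \<in> borel_measurable M"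
      using wM borel_measurable_integrable[OF int_nth[OF that]] by (rule borel_measurable_times)
    show "AE \<omega> in M. norm (w \<omega> $ i * h \<omega> $ i) \<le> norm (B * h \<omega> $ i)"
      using bnd[of i] by eventually_elim (simp add: abs_mult mult_right_mono)
  qed
  have "integrable M v" using Bochner_Integration.integrable_add[OF e g] by simp
  have "(\<integral>\<omega>. w \<omega> $ i * v \<omega> $ i \<partial>M) = (\<integral>\<omega>. w \<omega> $ i * g \<omega> $ i \<partial>M)" for i
  proof -
    have "(\<integral>\<omega>. w \<omega> $ i * g \<omega> $ i \<partial>M)
        = (\<integral>\<omega>. w \<omega> $ i * real_cond_exp M F (\<lambda>\<omega>'. v \<omega>' $ i) \<omega> \<partial>M)"
      using unbiased[of i] wM int_mult[OF g, of i] real_cond_exp_intg(1)[OF int_mult[OF \<open>integrable M v\<close>] wF vM]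
      by (intro integral_cong_AE) auto
    also have "\<dots> = (\<integral>\<omega>. w \<omega> $ i * v \<omega> $ i \<partial>M)"
      by (rule real_cond_exp_intg(2)[OF int_mult[OF \<open>integrable M v\<close>] wF vM])
    finally show ?thesis by simp
  qed
  then have "(\<integral>\<omega>. w \<omega> $ i * (v \<omega> - g \<omega>) $ i \<partial>M) = 0" for i
    using int_mult[OF \<open>integrable M v\<close>] int_mult[OF g]
    by (simp add: right_diff_distrib)
  moreover have "(v \<omega> - g \<omega>) \<bullet> w \<omega> = (\<Sum>i\<in>UNIV. w \<omega> $ i * (v \<omega> - g \<omega>) $ i)" for \<omega>
    by (simp add: inner_vec_def mult.commute)
  ultimately show ?int ?zero
    using int_mult[OF e] by (simp_all add: Bochner_Integration.integral_sum del: vector_minus_component)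
qed

section \<open>The one-step inequality\<close>

lemma inner_le_weighted_squares:
  fixes a b :: "'a::real_inner"
  assumes "0 < c"
  shows "a \<bullet> b \<le> (norm a)\<^sup>2 / (2 * c) + c / 2 * (norm b)\<^sup>2"
proof -
  have "0 \<le> (norm (a - c *\<^sub>R b))\<^sup>2" by simp
  then have "2 * c * (a \<bullet> b) \<le> (norm a)\<^sup>2 + c\<^sup>2 * (norm b)\<^sup>2"
    unfolding power2_norm_eq_inner
    by (simp add: inner_diff_left inner_diff_right inner_commute power2_eq_square algebra_simps)
  then show ?thesis using assms by (simp add: field_simps power2_eq_square)
qed

text \<open>The three-point inequality leaves a negative multiple \<open>(\<beta> + c) / 2\<close>
  of the squared step length. The share \<open>\<beta> / 2\<close> pays for the smoothness error and
  the share \<open>c / 2\<close> for the noise along \<open>z - x\<close>.\<close>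

lemma proximal_gradient_step:
  fixes f1 f2 :: "real ^ 'n \<Rightarrow> real"
  assumes D: "is_interval D" and PD: "P \<subseteq> D"
    and smooth: "smooth_with_gradient_on \<beta> D f1 g"
    and nonneg: "\<And>z. z \<in> D \<Longrightarrow> 0 \<le> f1 z" and mono: "mono_on D f1"
    and dr: "dr_submodular_on D f1" and conc: "concave_on P f2"
    and x: "x \<in> P" and y: "y \<in> P" and c: "0 < c" and \<eta>: "1 / \<eta> = \<beta> + c"
    and prox: "is_prox P (\<lambda>z. - (\<eta> * f2 z)) (x + \<eta> *\<^sub>R v) z"
  shows "f1 y + f2 y - f1 x - f1 z - f2 z + (v - g x) \<bullet> (y - x)
    \<le> (\<beta> + c) / 2 * ((norm (x - y))\<^sup>2 - (norm (z - y))\<^sup>2) + (norm (v - g x))\<^sup>2 / (2 * c)"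
proof -
  have "0 \<le> \<beta>" using smooth by (auto simp: smooth_with_gradient_on_def lipschitz_on_def)
  with c \<eta> have "0 < \<eta>" by (smt (verit) zero_less_divide_1_iff)
  have z: "z \<in> P" using prox by (auto simp: is_prox_def is_arg_min_linorder)
  have deriv: "(f1 has_derivative (\<bullet>) (g x)) (at x within D)"
    using smooth PD x by (auto simp: smooth_with_gradient_on_def)
  have "convex_on P (\<lambda>z. - (\<eta> * f2 z))"
    using convex_on_cmul[of \<eta> P "\<lambda>z. - f2 z"] conc \<open>0 < \<eta>\<close> by (simp add: concave_on_def)
  from is_prox_three_point[OF prox this y]
  have "\<eta> * (f2 y - f2 z + v \<bullet> (y - z)) \<le>
      1 / 2 * ((norm (x - y))\<^sup>2 - (norm (z - y))\<^sup>2 - (norm (z - x))\<^sup>2)"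
    unfolding power2_norm_eq_inner
    by (simp add: inner_add_left inner_add_right inner_diff_left inner_diff_right inner_commute field_simps)
  then have "f2 y - f2 z + v \<bullet> (y - z) \<le>
      (1 / 2 * ((norm (x - y))\<^sup>2 - (norm (z - y))\<^sup>2 - (norm (z - x))\<^sup>2)) * (1 / \<eta>)"
    using \<open>0 < \<eta>\<close> by (simp add: field_simps)
  then have step: "f2 y - f2 z + v \<bullet> (y - z) \<le>
      (\<beta> + c) / 2 * ((norm (x - y))\<^sup>2 - (norm (z - y))\<^sup>2) - (\<beta> + c) / 2 * (norm (z - x))\<^sup>2"
    unfolding \<eta> by (simp add: field_simps)
  have sub: "f1 y - 2 * f1 x \<le> g x \<bullet> (y - x)"
    using dr_submodular_on_gradient_bound[OF D dr deriv mono nonneg] PD x y by blast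
  have desc: "f1 x + g x \<bullet> (z - x) - \<beta> / 2 * (norm (z - x))\<^sup>2 \<le> f1 z"
    using smooth_with_gradient_on_lower_bound[OF is_interval_convex[OF D] smooth] PD x z by blast
  have young: "(v - g x) \<bullet> (z - x) \<le> (norm (v - g x))\<^sup>2 / (2 * c) + c / 2 * (norm (z - x))\<^sup>2"
    using c by (rule inner_le_weighted_squares)
  \<comment> \<open>The noise is split between \<open>y - x\<close> and \<open>z - x\<close>. The
    first direction will be determined by the history and average out; \<open>z\<close> depends on
    \<open>v\<close>, so the second has to be absorbed pointwise by \<open>young\<close>.\<close>
  have "v \<bullet> (y - z) = g x \<bullet> (y - x) - g x \<bullet> (z - x) + (v - g x) \<bullet> (y - x) - (v - g x) \<bullet> (z - x)"
    by (simp add: inner_diff_left inner_diff_right)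
  with step sub desc young show ?thesis by (simp add: add_divide_distrib distrib_right)
qed

section \<open>Summation over the iterations, expectation and the choice of step size\<close>

theorem theorem2:
  fixes P D :: "(real ^ 'n) set"
    and f1 f2 :: "real ^ 'n \<Rightarrow> real"
    and grad_f1 :: "real ^ 'n \<Rightarrow> real ^ 'n"
    and M :: "'w measure"
    and x v :: "nat \<Rightarrow> 'w \<Rightarrow> real ^ 'n"
    and x0 xstar :: "real ^ 'n"
    and \<beta> \<sigma> \<Delta> :: real
    and \<eta> :: "nat \<Rightarrow> real"
    and T :: nat
  assumes "convex P" and "P \<subseteq> {z. 0 \<le> z}"
    and "is_interval D" and "P \<subseteq> D"
    and "smooth_with_gradient_on \<beta> D f1 grad_f1"
    and "\<forall>z\<in>D. 0 \<le> f1 z"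
    and "mono_on D f1"
    and "dr_submodular_on D f1"
    and "\<forall>z\<in>P. 0 \<le> f2 z"
    and "concave_on P f2"
    and "is_arg_max (\<lambda>z. f1 z + f2 z) (\<lambda>z. z \<in> P) xstar"
    and "\<forall>y\<in>P. \<forall>z\<in>P. norm (y - z) \<le> \<Delta>"
    and "prob_space M"
    and "\<forall>t. x t \<in> borel_measurable M"
    and "\<forall>t. v t \<in> borel_measurable M"
    and "x0 \<in> P" and "\<forall>\<omega>\<in>space M. x 0 \<omega> = x0"
    and "\<forall>t. \<forall>\<omega>\<in>space M.
           is_prox P (\<lambda>z. - (\<eta> t * f2 z)) (x t \<omega> + \<eta> t *\<^sub>R v t \<omega>) (x (Suc t) \<omega>)"
    and "\<forall>t i. AE \<omega> in M.
           real_cond_exp M (history_algebra M x t) (\<lambda>\<omega>'. v t \<omega>' $ i) \<omega> = grad_f1 (x t \<omega>) $ i"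
    and "\<sigma> > 0"
    and "\<forall>t. integrable M (\<lambda>\<omega>. (norm (v t \<omega> - grad_f1 (x t \<omega>)))\<^sup>2)"
    and "\<forall>t. (\<integral>\<omega>. (norm (v t \<omega> - grad_f1 (x t \<omega>)))\<^sup>2 \<partial>M) \<le> \<sigma>\<^sup>2"
    and "T > 0"
    and "\<forall>t. \<eta> t = 1 / (\<beta> + \<sigma> / \<Delta> * sqrt (2 * real T))"
  shows "(\<integral>\<omega>. (MAX t\<in>{0..T}. f1 (x t \<omega>) + f2 (x t \<omega>)) \<partial>M)
           \<ge> 1 / 2 * (f1 xstar + f2 xstar) - \<beta> * \<Delta>\<^sup>2 / (4 * real T) - \<sigma> * \<Delta> / sqrt (2 * real T)"
proof -
  interpret prob_space M by fact
  note is_D = \<open>is_interval D\<close> and PD = \<open>P \<subseteq> D\<close> and smooth = \<open>smooth_with_gradient_on \<beta> D f1 grad_f1\<close>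
  let ?F = "\<lambda>z. f1 z + f2 z"
  let ?Y = "\<lambda>\<omega>. MAX t\<in>{0..T}. ?F (x t \<omega>)"
  have xs: "xstar \<in> P" and F_le: "\<And>z. z \<in> P \<Longrightarrow> ?F z \<le> ?F xstar"
    using \<open>is_arg_max ?F (\<lambda>z. z \<in> P) xstar\<close> by (auto simp: is_arg_max_linorder)
  have f1_nonneg: "\<And>z. z \<in> D \<Longrightarrow> 0 \<le> f1 z" and f2_nonneg: "\<And>z. z \<in> P \<Longrightarrow> 0 \<le> f2 z"
    using \<open>\<forall>z\<in>D. 0 \<le> f1 z\<close> \<open>\<forall>z\<in>P. 0 \<le> f2 z\<close> by auto
  have F_nonneg: "0 \<le> ?F z" if "z \<in> P" for z
    using that PD f1_nonneg f2_nonneg by (auto intro!: add_nonneg_nonneg)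
  have diam: "\<And>y z. y \<in> P \<Longrightarrow> z \<in> P \<Longrightarrow> norm (y - z) \<le> \<Delta>"
    using \<open>\<forall>y\<in>P. \<forall>z\<in>P. norm (y - z) \<le> \<Delta>\<close> by blast
  have prox: "is_prox P (\<lambda>z. - (\<eta> t * f2 z)) (x t \<omega> + \<eta> t *\<^sub>R v t \<omega>) (x (Suc t) \<omega>)"
    if "\<omega> \<in> space M" for t \<omega>
    using assms(18) that by blast
  have x_P: "x t \<omega> \<in> P" if "\<omega> \<in> space M" for t \<omega>
  proof (cases t)
    case 0
    then show ?thesis using assms(16,17) that by simp
  next
    case (Suc n)
    then show ?thesis using prox[OF that, of n] by (auto simp: is_prox_def is_arg_min_linorder)
  qed
  have "0 \<le> \<Delta>" using diam[OF xs xs] by simp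
  have "0 \<le> \<beta>" using smooth by (auto simp: smooth_with_gradient_on_def lipschitz_on_def)
  have x_meas: "x t \<in> borel_measurable M" and v_meas: "v t \<in> borel_measurable M" for t
    using assms(14,15) by auto
  show ?thesis
  \<comment> \<open>For \<open>\<Delta> = 0\<close> the quotient \<open>\<sigma> / \<Delta>\<close>
    has the default value 0, so the step size carries no noise margin. But then \<open>P\<close> is
    the single point \<open>xstar\<close>, all iterates equal it and both error terms
    vanish.\<close>
  proof (cases "\<Delta> = 0")
    case True
    have "(\<integral>\<omega>. ?Y \<omega> \<partial>M) = (\<integral>\<omega>. ?F xstar \<partial>M)"
    proof (rule Bochner_Integration.integral_cong)
      fix \<omega> assume "\<omega> \<in> space M"
      then have "x t \<omega> = xstar" for t using diam[OF x_P xs, of \<omega> t] True by simp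
      then show "?Y \<omega> = ?F xstar" by (simp add: image_constant_conv)
    qed simp
    then show ?thesis using F_nonneg[OF xs] True by (simp add: prob_space)
  next
    case False
    with \<open>0 \<le> \<Delta>\<close> have "0 < \<Delta>" by simp
    define c where "c = \<sigma> / \<Delta> * sqrt (2 * real T)"
    have "0 < c" using \<open>0 < \<Delta>\<close> \<open>0 < \<sigma>\<close> \<open>0 < T\<close> by (simp add: c_def)
    have \<eta>: "1 / \<eta> t = \<beta> + c" for t using assms(24) by (simp add: c_def)
    have \<eta>_nz: "\<eta> t \<noteq> 0" for t using \<eta>[of t] \<open>0 < c\<close> \<open>0 \<le> \<beta>\<close> by auto
    let ?e = "\<lambda>t \<omega>. v t \<omega> - grad_f1 (x t \<omega>)"
    \<comment> \<open>Continuity of \<open>f1\<close> and \<open>grad_f1\<close> is known on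
      \<open>D\<close> only, so the iterates are viewed as maps into the subspace \<open>D\<close>
      before composing.\<close>
    have x_D: "x t \<in> measurable M (restrict_space borel D)" for t
      using x_meas x_P PD by (intro measurable_restrict_space2) auto
    have "continuous_on D f1"
      using smooth unfolding smooth_with_gradient_on_def
      by (meson continuous_on_eq_continuous_within has_derivative_continuous)
    then have f1_meas: "(\<lambda>\<omega>. f1 (x t \<omega>)) \<in> borel_measurable M" for t
      using borel_measurable_continuous_on_restrict measurable_compose x_D by blast
    have "continuous_on D grad_f1"
      using smooth by (auto simp: smooth_with_gradient_on_def intro: lipschitz_on_continuous_on)
    then have g_meas: "(\<lambda>\<omega>. grad_f1 (x t \<omega>)) \<in> borel_measurable M" for t
      using borel_measurable_continuous_on_restrict measurable_compose x_D by blast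
    have f2_meas: "(\<lambda>\<omega>. f2 (x t \<omega>)) \<in> borel_measurable M" for t
    \<comment> \<open>The starting point is constant. Every later iterate is a proximal point, which
      gives measurability of \<open>- (\<eta> n * f2 (x t \<omega>))\<close>; the nonzero step size
      is then divided out.\<close>
    proof (cases t)
      case 0
      then show ?thesis
        using assms(17) measurable_cong[of M "\<lambda>\<omega>. f2 (x t \<omega>)" "\<lambda>\<omega>. f2 x0" borel] by simp
    next
      case (Suc n)
      have "(\<lambda>\<omega>. x n \<omega> + \<eta> n *\<^sub>R v n \<omega>) \<in> borel_measurable M"
        using x_meas[of n] v_meas[of n] by measurable
      from borel_measurable_is_prox[OF this x_meas prox]
      have "(\<lambda>\<omega>. - (\<eta> n * f2 (x t \<omega>))) \<in> borel_measurable M"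
        using Suc by simp
      then have "(\<lambda>\<omega>. - (\<eta> n * f2 (x t \<omega>)) / (- \<eta> n)) \<in> borel_measurable M"
        by measurable
      then show ?thesis using \<eta>_nz by simp
    qed
    have Y_meas: "?Y \<in> borel_measurable M"
      using f1_meas f2_meas by (intro borel_measurable_Max borel_measurable_add) auto
    have F_le_Y: "?F (x t \<omega>) \<le> ?Y \<omega>" if "t \<le> T" for t \<omega>
      using that by (intro Max_ge) auto
    have Y_int: "integrable M ?Y"
    proof (rule integrable_const_bound[OF _ Y_meas])
      show "AE \<omega> in M. norm (?Y \<omega>) \<le> ?F xstar"
      proof (rule AE_I2)
        fix \<omega> assume \<omega>: "\<omega> \<in> space M"
        have "?Y \<omega> \<le> ?F xstar" using F_le[OF x_P[OF \<omega>]] by (subst Max_le_iff) auto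
        moreover have "0 \<le> ?Y \<omega>" by (rule order_trans[OF F_nonneg[OF x_P[OF \<omega>]] F_le_Y]) (rule le0)
        ultimately show "norm (?Y \<omega>) \<le> ?F xstar" by simp
      qed
    qed
    have g_int: "integrable M (\<lambda>\<omega>. grad_f1 (x t \<omega>))" for t
    proof (rule integrable_const_bound[OF _ g_meas])
      show "AE \<omega> in M. norm (grad_f1 (x t \<omega>)) \<le> norm (grad_f1 xstar) + \<beta> * \<Delta>"
      proof (rule AE_I2)
        fix \<omega> assume \<omega>: "\<omega> \<in> space M"
        have "norm (grad_f1 (x t \<omega>) - grad_f1 xstar) \<le> \<beta> * norm (x t \<omega> - xstar)"
          using smooth PD xs x_P[OF \<omega>] unfolding smooth_with_gradient_on_def
          by (metis dist_norm lipschitz_onD subsetD)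
        also have "\<dots> \<le> \<beta> * \<Delta>"
          using diam[OF x_P[OF \<omega>] xs] \<open>0 \<le> \<beta>\<close> by (rule mult_left_mono)
        finally show "norm (grad_f1 (x t \<omega>)) \<le> norm (grad_f1 xstar) + \<beta> * \<Delta>"
          using norm_triangle_ineq2[of "grad_f1 (x t \<omega>)" "grad_f1 xstar"] by linarith
      qed
    qed
    have e_meas: "?e t \<in> borel_measurable M" for t
      using v_meas[of t] g_meas[of t] by measurable
    have e2_int: "integrable M (\<lambda>\<omega>. (norm (?e t \<omega>))\<^sup>2)" for t using assms(21) by blast
    have e_int: "integrable M (?e t)" for t
      using finite_measure_axioms e_meas e2_int by (rule integrable_norm_of_square_integrable)
    have x_history: "(\<lambda>\<omega>. xstar - x t \<omega>) \<in> borel_measurable (history_algebra M x t)" for t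
      using measurable_history_algebra[of x t M] by measurable
    have unbiased: "AE \<omega> in M. real_cond_exp M (history_algebra M x t) (\<lambda>\<omega>'. v t \<omega>' $ i) \<omega> = grad_f1 (x t \<omega>) $ i"
      for t i
      using assms(19) by blast
    \<comment> \<open>The test direction is \<open>xstar - x t\<close>: measurable with respect to
      the history and bounded by \<open>\<Delta>\<close>.\<close>
    note dev = integral_inner_cond_exp_deviation[OF \<open>prob_space M\<close> subalgebra_history_algebra[OF x_meas]
        v_meas g_int e_int x_history diam[OF xs x_P] unbiased]
    have step: "?F xstar + ?e t \<omega> \<bullet> (xstar - x t \<omega>) \<le> 2 * ?Y \<omega>
        + (\<beta> + c) / 2 * ((norm (x t \<omega> - xstar))\<^sup>2 - (norm (x (Suc t) \<omega> - xstar))\<^sup>2)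
        + (norm (?e t \<omega>))\<^sup>2 / (2 * c)"
      if "\<omega> \<in> space M" "t < T" for \<omega> t
    proof -
      have "?F xstar - f1 (x t \<omega>) - ?F (x (Suc t) \<omega>) + ?e t \<omega> \<bullet> (xstar - x t \<omega>)
          \<le> (\<beta> + c) / 2 * ((norm (x t \<omega> - xstar))\<^sup>2 - (norm (x (Suc t) \<omega> - xstar))\<^sup>2)
            + (norm (?e t \<omega>))\<^sup>2 / (2 * c)"
        using proximal_gradient_step[OF is_D PD smooth _ assms(7,8,10) x_P[OF that(1)] xs
            \<open>0 < c\<close> \<eta> prox[OF that(1)]] f1_nonneg
        by (simp add: algebra_simps)
      \<comment> \<open>Since \<open>f2\<close> is nonnegative, \<open>f1 (x t \<omega>)\<close> is
        at most \<open>?F (x t \<omega>)\<close>. So one step is paid for by two values of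
        \<open>?F\<close>, both below the maximum: \<open>t < T\<close> keeps the index
        \<open>Suc t\<close> within \<open>{0..T}\<close>.\<close>
      moreover have "?F (x t \<omega>) \<le> ?Y \<omega>" "?F (x (Suc t) \<omega>) \<le> ?Y \<omega>"
        using that(2) by (intro F_le_Y; simp)+
      ultimately show ?thesis using f2_nonneg[OF x_P[OF that(1), of t]] by linarith
    qed
    have sum_step: "real T * ?F xstar + (\<Sum>t<T. ?e t \<omega> \<bullet> (xstar - x t \<omega>)) \<le>
        2 * real T * ?Y \<omega> + (\<beta> + c) / 2 * \<Delta>\<^sup>2 + (\<Sum>t<T. (norm (?e t \<omega>))\<^sup>2) / (2 * c)"
      if \<omega>: "\<omega> \<in> space M" for \<omega>
    proof -
      let ?n = "\<lambda>t. (norm (x t \<omega> - xstar))\<^sup>2"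
      have "(\<Sum>t<T. ?F xstar + ?e t \<omega> \<bullet> (xstar - x t \<omega>)) \<le>
          (\<Sum>t<T. 2 * ?Y \<omega> + (\<beta> + c) / 2 * (?n t - ?n (Suc t)) + (norm (?e t \<omega>))\<^sup>2 / (2 * c))"
        using step[OF \<omega>] by (intro sum_mono) auto
      also have "\<dots> = 2 * real T * ?Y \<omega> + (\<beta> + c) / 2 * (?n 0 - ?n T)
          + (\<Sum>t<T. (norm (?e t \<omega>))\<^sup>2) / (2 * c)"
        using sum_lessThan_telescope'[of ?n T]
        by (simp add: sum.distrib sum_distrib_left[symmetric] sum_divide_distrib[symmetric]
            del: times_divide_eq_left)
      also have "(\<beta> + c) / 2 * (?n 0 - ?n T) \<le> (\<beta> + c) / 2 * \<Delta>\<^sup>2"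
      proof (rule mult_left_mono)
        have "?n 0 \<le> \<Delta>\<^sup>2" using diam[OF x_P[OF \<omega>] xs] by (intro power_mono) auto
        then show "?n 0 - ?n T \<le> \<Delta>\<^sup>2" by (smt (verit) zero_le_power2)
      qed (use \<open>0 \<le> \<beta>\<close> \<open>0 < c\<close> in simp)
      finally show ?thesis by (simp add: sum.distrib)
    qed
    have "real T * ?F xstar = (\<integral>\<omega>. real T * ?F xstar + (\<Sum>t<T. ?e t \<omega> \<bullet> (xstar - x t \<omega>)) \<partial>M)"
      using dev by (simp add: Bochner_Integration.integral_sum prob_space)
    also have "\<dots> \<le> (\<integral>\<omega>. 2 * real T * ?Y \<omega> + (\<beta> + c) / 2 * \<Delta>\<^sup>2
        + (\<Sum>t<T. (norm (?e t \<omega>))\<^sup>2) / (2 * c) \<partial>M)"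
      using dev Y_int e2_int sum_step by (intro integral_mono) auto
    also have "\<dots> = 2 * real T * (\<integral>\<omega>. ?Y \<omega> \<partial>M) + (\<beta> + c) / 2 * \<Delta>\<^sup>2
        + (\<Sum>t<T. (\<integral>\<omega>. (norm (?e t \<omega>))\<^sup>2 \<partial>M)) / (2 * c)"
      using Y_int e2_int by (simp add: Bochner_Integration.integral_sum prob_space)
    also have "\<dots> \<le> 2 * real T * (\<integral>\<omega>. ?Y \<omega> \<partial>M) + (\<beta> + c) / 2 * \<Delta>\<^sup>2 + real T * \<sigma>\<^sup>2 / (2 * c)"
    proof -
      have "(\<Sum>t<T. (\<integral>\<omega>. (norm (?e t \<omega>))\<^sup>2 \<partial>M)) \<le> (\<Sum>t<T. \<sigma>\<^sup>2)"
        using assms(22) by (intro sum_mono) auto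
      then show ?thesis using \<open>0 < c\<close> by (simp add: divide_right_mono)
    qed
    finally have main: "real T * ?F xstar \<le>
        2 * real T * (\<integral>\<omega>. ?Y \<omega> \<partial>M) + (\<beta> + c) / 2 * \<Delta>\<^sup>2 + real T * \<sigma>\<^sup>2 / (2 * c)" .
    \<comment> \<open>In terms of \<open>r\<close> both noise contributions become multiples of
      \<open>\<sigma> * \<Delta> * r\<close>: one half from the step-size penalty and one quarter
      from the variance.\<close>
    define r where "r = sqrt (2 * real T)"
    have "0 < r" and r2: "real T = r\<^sup>2 / 2" using \<open>0 < T\<close> by (simp_all add: r_def)
    have c: "c = \<sigma> / \<Delta> * r" by (simp add: c_def r_def)
    have "c * \<Delta>\<^sup>2 = \<sigma> * \<Delta> * r" and "real T * \<sigma>\<^sup>2 / (2 * c) = \<sigma> * \<Delta> * r / 4"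
      using \<open>0 < \<Delta>\<close> \<open>0 < \<sigma>\<close> \<open>0 < r\<close> by (simp_all add: c r2 power2_eq_square field_simps)
    moreover have "(\<beta> + c) / 2 * \<Delta>\<^sup>2 = \<beta> * \<Delta>\<^sup>2 / 2 + c * \<Delta>\<^sup>2 / 2"
      by (simp add: distrib_right add_divide_distrib)
    ultimately have "real T * ?F xstar \<le>
        2 * real T * (\<integral>\<omega>. ?Y \<omega> \<partial>M) + \<beta> * \<Delta>\<^sup>2 / 2 + 3 / 4 * (\<sigma> * \<Delta> * r)"
      using main by linarith
    \<comment> \<open>Rounding 3/4 up to 1 gives the stated noise constant after division by
      \<open>2 * real T\<close>, which equals \<open>r\<^sup>2\<close>.\<close>
    also have "\<dots> \<le> 2 * real T * (\<integral>\<omega>. ?Y \<omega> \<partial>M) + \<beta> * \<Delta>\<^sup>2 / 2 + \<sigma> * \<Delta> * r"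
      using \<open>0 < \<Delta>\<close> \<open>0 < \<sigma>\<close> \<open>0 < r\<close> by simp
    also have "\<sigma> * \<Delta> * r = 2 * real T * (\<sigma> * \<Delta> / r)"
      using \<open>0 < r\<close> by (simp add: r2 power2_eq_square)
    also have "\<beta> * \<Delta>\<^sup>2 / 2 = 2 * real T * (\<beta> * \<Delta>\<^sup>2 / (4 * real T))"
      using \<open>0 < T\<close> by simp
    finally have "2 * real T * (1 / 2 * ?F xstar) \<le>
        2 * real T * ((\<integral>\<omega>. ?Y \<omega> \<partial>M) + \<beta> * \<Delta>\<^sup>2 / (4 * real T) + \<sigma> * \<Delta> / r)"
      by (simp add: distrib_left)
    then have "1 / 2 * ?F xstar \<le> (\<integral>\<omega>. ?Y \<omega> \<partial>M) + \<beta> * \<Delta>\<^sup>2 / (4 * real T) + \<sigma> * \<Delta> / r"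
      by (rule mult_left_le_imp_le) (use \<open>0 < T\<close> in simp)
    then show ?thesis unfolding r_def by linarith
  qed
qed

end
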